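(* Let $A\in\mathbb{R}^{m\times n}$, $b\in\mathbb{R}^m$, $c\in\mathbb{R}^n$, and let $A^\Delta\in\mathbb{R}^{m\times n}$, $b^\Delta\in\mathbb{R}^m$, $c^\Delta\in\mathbb{R}^n$ be entrywise nonnegative. Suppose that the linear program $\min\, c^Tx$ subject to $Ax=b,\ x\ge 0$ has a unique optimal solution $x^*$ which is nondegenerate, corresponding to a basis $B$, and let $y^*$ be an optimal solution of the dual problem $\max\, b^Ty$ subject to $A^Ty\le c$. Then $$d_w(A,b,c,A^\Delta,b^\Delta,c^\Delta)=|y^*|^TA^\Delta_B x^*_B+|y^*|^Tb^\Delta+(x^*_B)^Tc^\Delta_B .$$
   Context: For $A\in\mathbb{R}^{m\times n}$, $b\in\mathbb{R}^m$, $c\in\mathbb{R}^n$, let $f(A,b,c)$ denote the optimal value of $\min\, c^Tx$ subject to $Ax=b,\ x\ge0$ (with the usual extended-real conventions: $+\infty$ if infeasible, $-\infty$ if unbounded). Inequalities and absolute values of vectors and matrices are entrywise. For $\alpha\ge0$ put $\boldsymbol{A}_\alpha=\{A' : A-\alpha A^\Delta\le A'\le A+\alpha A^\Delta\}$, $\boldsymbol{b}_\alpha=\{b' : b-\alpha b^\Delta\le b'\le b+\alpha b^\Delta\}$, $\boldsymbol{c}_\alpha=\{c' : c-\alpha c^\Delta\le c'\le c+\alpha c^\Delta\}$, and define the worst case optimal value $$\overline{f}(\boldsymbol{A}_\alpha,\boldsymbol{b}_\alpha,\boldsymbol{c}_\alpha)=\max\{f(A',b',c') : A'\in\boldsymbol{A}_\alpha,\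 b'\in\boldsymbol{b}_\alpha,\ c'\in\boldsymbol{c}_\alpha\}.$$ The worst-case optimal value derivative is $$d_w(A,b,c,A^\Delta,b^\Delta,c^\Delta)=\lim_{\alpha\to0^+}\frac{\overline{f}(\boldsymbol{A}_\alpha,\boldsymbol{b}_\alpha,\boldsymbol{c}_\alpha)-f(A,b,c)}{\alpha}.$$ For an index set $B\subseteq\{1,\dots,n\}$, $A_B$ denotes the restriction of $A$ to the columns indexed by $B$ (similarly $x_B$, $c_B$ for vectors); $B$ is a basis if $A_B$ is (square and) nonsingular. A basic solution corresponding to $B$ has $x_B=A_B^{-1}b$ and all other entries zero; it is nondegenerate if $x_B>0$. *)

theory Defs
  imports "HOL-Analysis.Analysis"
begin

(* On vectors and matrices, \<le> and \<bar>_\<bar> are the library's entrywise operations.  The library's <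
   on vectors is not entrywise, so strict positivity is spelled out componentwise. *)

definition primal_feasible :: "real^'n^'m \<Rightarrow> real^'m \<Rightarrow> (real^'n) set" where
  "primal_feasible A b = {x. A *v x = b \<and> 0 \<le> x}"

definition primal_optimal :: "real^'n^'m \<Rightarrow> real^'m \<Rightarrow> real^'n \<Rightarrow> real^'n \<Rightarrow> bool" where
  "primal_optimal A b c x \<longleftrightarrow>
     x \<in> primal_feasible A b \<and> (\<forall>z \<in> primal_feasible A b. c \<bullet> x \<le> c \<bullet> z)"

definition dual_feasible :: "real^'n^'m \<Rightarrow> real^'n \<Rightarrow> (real^'m) set" where
  "dual_feasible A c = {y. transpose A *v y \<le> c}"

definition dual_optimal :: "real^'n^'m \<Rightarrow> real^'m \<Rightarrow> real^'n \<Rightarrow> real^'m \<Rightarrow> bool" where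
  "dual_optimal A b c y \<longleftrightarrow>
     y \<in> dual_feasible A c \<and> (\<forall>z \<in> dual_feasible A c. b \<bullet> z \<le> b \<bullet> y)"

(* Infimum in the extended reals: \<infinity> if infeasible, -\<infinity> if unbounded below. *)
definition opt_value :: "real^'n^'m \<Rightarrow> real^'m \<Rightarrow> real^'n \<Rightarrow> ereal" where
  "opt_value A b c = (INF x \<in> primal_feasible A b. ereal (c \<bullet> x))"

definition interval_around :: "'a::{ord, real_vector} \<Rightarrow> 'a \<Rightarrow> real \<Rightarrow> 'a set" where
  "interval_around M M\<Delta> \<alpha> = {M - \<alpha> *\<^sub>R M\<Delta> .. M + \<alpha> *\<^sub>R M\<Delta>}"

(* A genuine maximum: the value is only meaningful if the supremum is attained. *)
definition worst_case_value ::
  "(real^'n^'m) set \<Rightarrow> (real^'m) set \<Rightarrow> (real^'n) set \<Rightarrow> ereal" where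
  "worst_case_value \<A> \<B> \<C> =
     (GREATEST v. v \<in> {opt_value A' b' c' | A' b' c'. A' \<in> \<A> \<and> b' \<in> \<B> \<and> c' \<in> \<C>})"

(* The limit d_w exists and equals d. *)
definition has_worst_case_derivative ::
  "real^'n^'m \<Rightarrow> real^'m \<Rightarrow> real^'n \<Rightarrow> real^'n^'m \<Rightarrow> real^'m \<Rightarrow> real^'n \<Rightarrow> ereal \<Rightarrow> bool" where
  "has_worst_case_derivative A b c A\<Delta> b\<Delta> c\<Delta> d \<longleftrightarrow>
     ((\<lambda>\<alpha>. (worst_case_value (interval_around A A\<Delta> \<alpha>) (interval_around b b\<Delta> \<alpha>)
                (interval_around c c\<Delta> \<alpha>) - opt_value A b c) / ereal \<alpha>) \<longlongrightarrow> d) (at_right 0)"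

(* An index set B with as many elements as A has rows is represented by an injective enumeration
   B :: 'm \<Rightarrow> 'n of its elements, so that A_B is an honest square matrix; the index set itself is
   range B. *)

definition restrict_vec :: "real^'n \<Rightarrow> ('m \<Rightarrow> 'n) \<Rightarrow> real^'m" where
  "restrict_vec x B = (\<chi> k. x $ B k)"

definition restrict_cols :: "real^'n^'m \<Rightarrow> ('m \<Rightarrow> 'n) \<Rightarrow> real^'m^'m" where
  "restrict_cols A B = (\<chi> i k. A $ i $ B k)"

definition is_basis :: "real^'n^'m \<Rightarrow> ('m \<Rightarrow> 'n) \<Rightarrow> bool" where
  "is_basis A B \<longleftrightarrow> inj B \<and> invertible (restrict_cols A B)"

definition basic_solution :: "real^'n^'m \<Rightarrow> real^'m \<Rightarrow> ('m \<Rightarrow> 'n) \<Rightarrow> real^'n \<Rightarrow> bool" where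
  "basic_solution A b B x \<longleftrightarrow>
     restrict_vec x B = matrix_inv (restrict_cols A B) *v b \<and> (\<forall>j. j \<notin> range B \<longrightarrow> x $ j = 0)"

definition nondegenerate :: "real^'n \<Rightarrow> ('m::finite \<Rightarrow> 'n) \<Rightarrow> bool" where
  "nondegenerate x B \<longleftrightarrow> (\<forall>k. 0 < restrict_vec x B $ k)"

end

theory Submission
  imports Defs
begin

text \<open>
  Uniqueness and nondegeneracy make every nonbasic reduced cost strictly positive, so B stays an
  optimal basis for all data near (A, b, c). There the optimal value is c'_B \<bullet> u' with
  A'_B u' = b', which is continuous by Cramer's rule, so the maximum over the box is attained.
  With y^T A_B = c_B^T, the value differs from the original one by exactly
  (c' - c)_B \<bullet> u' - y \<bullet> (A' - A)_B u' + y \<bullet> (b' - b).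
  Over the box of radius \<open>\<alpha>\<close> this is at most \<open>\<alpha>\<close> h(u'), where h(u') is the claimed
  derivative with u' in place of x_B, and equality holds at the vertex chosen by the signs of y.
  Since u' tends to x_B uniformly on the shrinking box, squeezing gives the limit h(x_B).
\<close>

section \<open>Square systems solved by determinants, and continuity of the solution\<close>

definition cramer_solve :: "real^'m^'m \<Rightarrow> real^'m \<Rightarrow> real^'m" where
  "cramer_solve M v = (\<chi> k. det (\<chi> i j. if j = k then v $ i else M $ i $ j) / det M)"

lemma cramer_solve_iff:
  assumes "det M \<noteq> 0"
  shows "M *v u = v \<longleftrightarrow> u = cramer_solve M v"
  unfolding cramer_solve_def by (rule cramer[OF assms])

lemma mult_cramer_solve: "det M \<noteq> 0 \<Longrightarrow> M *v cramer_solve M v = v"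
  by (simp add: cramer_solve_iff)

lemma tendsto_det [tendsto_intros]:
  fixes f :: "'a \<Rightarrow> real^'m^'m"
  assumes "(f \<longlongrightarrow> M) F"
  shows "((\<lambda>t. det (f t)) \<longlongrightarrow> det M) F"
  unfolding det_def by (intro tendsto_intros assms)

text \<open>The reason for writing solutions by Cramer's rule rather than with
  \<open>matrix_inv\<close>: each component is a quotient of polynomials in the data, so only a
  nonzero denominator in the limit is required.\<close>

lemma tendsto_cramer_solve [tendsto_intros]:
  assumes "(f \<longlongrightarrow> M) F" and "(g \<longlongrightarrow> v) F" and "det M \<noteq> 0"
  shows "((\<lambda>t. cramer_solve (f t) (g t)) \<longlongrightarrow> cramer_solve M v) F"
proof -
  have "((\<lambda>t. if j = k then g t $ i else f t $ i $ j) \<longlongrightarrow> (if j = k then v $ i else M $ i $ j)) F"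
    for i j k
    using assms by (cases "j = k") (auto intro!: tendsto_intros)
  then show ?thesis
    unfolding cramer_solve_def by (intro tendsto_intros assms)
qed

lemma tendsto_matrix_vector_mult [tendsto_intros]:
  fixes f :: "'a \<Rightarrow> real^'n^'m"
  assumes "(f \<longlongrightarrow> M) F" and "(g \<longlongrightarrow> v) F"
  shows "((\<lambda>t. f t *v g t) \<longlongrightarrow> M *v v) F"
  unfolding matrix_vector_mult_def by (intro tendsto_intros assms)

lemma tendsto_vector_matrix_mult [tendsto_intros]:
  fixes f :: "'a \<Rightarrow> real^'n^'m"
  assumes "(f \<longlongrightarrow> M) F" and "(g \<longlongrightarrow> v) F"
  shows "((\<lambda>t. g t v* f t) \<longlongrightarrow> v v* M) F"
  unfolding vector_matrix_mult_def by (intro tendsto_intros assms)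

lemma tendsto_transpose [tendsto_intros]:
  fixes f :: "'a \<Rightarrow> real^'n^'m"
  assumes "(f \<longlongrightarrow> M) F"
  shows "((\<lambda>t. transpose (f t)) \<longlongrightarrow> transpose M) F"
  unfolding transpose_def by (intro tendsto_intros assms)

lemma tendsto_restrict_vec [tendsto_intros]:
  assumes "(f \<longlongrightarrow> v) F"
  shows "((\<lambda>t. restrict_vec (f t) B) \<longlongrightarrow> restrict_vec v B) F"
  unfolding restrict_vec_def by (intro tendsto_intros assms)

lemma tendsto_restrict_cols [tendsto_intros]:
  assumes "(f \<longlongrightarrow> M) F"
  shows "((\<lambda>t. restrict_cols (f t) B) \<longlongrightarrow> restrict_cols M B) F"
  unfolding restrict_cols_def by (intro tendsto_intros assms)

section \<open>Filling up basic components by zeros\<close>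

definition basic_extension :: "('m::finite \<Rightarrow> 'n) \<Rightarrow> real^'m \<Rightarrow> real^'n" where
  "basic_extension B u = (\<chi> j. \<Sum>k\<in>UNIV. if B k = j then u $ k else 0)"

text \<open>Since the extension is encoded as a sum over the indices that \<open>B\<close> maps to
  \<open>j\<close>, it is the adjoint of \<open>restrict_vec\<close>, and the proof is an exchange
  of two sums. Injectivity of \<open>B\<close> enters only when a restriction has to be
  undone.\<close>

lemma inner_basic_extension: "c \<bullet> basic_extension B u = restrict_vec c B \<bullet> u"
proof -
  have "c \<bullet> basic_extension B u = (\<Sum>j\<in>UNIV. \<Sum>k\<in>UNIV. if B k = j then c $ j * u $ k else 0)"
    by (auto simp: basic_extension_def inner_vec_def sum_distrib_left intro!: sum.cong)
  also have "\<dots> = (\<Sum>k\<in>UNIV. \<Sum>j\<in>UNIV. if B k = j then c $ j * u $ k else 0)"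
    by (rule sum.swap)
  also have "\<dots> = restrict_vec c B \<bullet> u"
    by (simp add: restrict_vec_def inner_vec_def)
  finally show ?thesis .
qed

lemma matrix_mult_basic_extension: "A *v basic_extension B u = restrict_cols A B *v u"
proof -
  have "restrict_vec (A $ i) B = restrict_cols A B $ i" for i
    by (simp add: restrict_vec_def restrict_cols_def)
  then show ?thesis
    by (subst vec_eq_iff) (simp only: matrix_vector_mul_component inner_basic_extension simp_thms)
qed

lemma basic_extension_nonneg: "0 \<le> u \<Longrightarrow> 0 \<le> basic_extension B u"
  by (auto simp: basic_extension_def less_eq_vec_def intro!: sum_nonneg)

lemma basic_extension_outside: "j \<notin> range B \<Longrightarrow> basic_extension B u $ j = 0"
  by (auto simp: basic_extension_def intro!: sum.neutral)

lemma basic_extension_restrict: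
  assumes "inj B" and "\<And>j. j \<notin> range B \<Longrightarrow> x $ j = 0"
  shows "basic_extension B (restrict_vec x B) = x"
proof -
  have "basic_extension B (restrict_vec x B) $ j = x $ j" for j
  proof (cases "j \<in> range B")
    case True
    then show ?thesis
      using assms(1) by (auto simp: restrict_vec_def basic_extension_def inj_eq)
  qed (simp add: assms basic_extension_outside)
  then show ?thesis by (simp add: vec_eq_iff)
qed

lemma restrict_vec_matrix_mult: "restrict_vec (y v* A) B = y v* restrict_cols A B"
  by (simp add: restrict_vec_def restrict_cols_def vector_matrix_mult_def)

section \<open>Strictly optimal bases and the value they determine\<close>

lemma inner_mono_nonneg:
  fixes v :: "real^'n"
  assumes "v \<le> w" and "0 \<le> z"
  shows "v \<bullet> z \<le> w \<bullet> z"
  using assms by (auto simp: inner_vec_def less_eq_vec_def intro!: sum_mono mult_right_mono)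

text \<open>The second \<open>cramer_solve\<close> is the dual vector with y A_B = c_B, so the last
  clause asks for positive nonbasic reduced costs; basic ones always vanish. All conditions are
  strict, finite in number and continuous in the data, which makes them stable under small
  perturbations.\<close>

definition basis_optimal :: "real^'n^'m \<Rightarrow> real^'m \<Rightarrow> real^'n \<Rightarrow> ('m \<Rightarrow> 'n) \<Rightarrow> bool" where
  "basis_optimal A b c B \<longleftrightarrow>
     det (restrict_cols A B) \<noteq> 0 \<and>
     (\<forall>k. 0 < cramer_solve (restrict_cols A B) b $ k) \<and>
     (\<forall>j. j \<notin> range B \<longrightarrow>
       (cramer_solve (transpose (restrict_cols A B)) (restrict_vec c B) v* A) $ j < c $ j)"

text \<open>At indices in \<open>range B\<close> the dual constraint is an equality by the choice of
  the dual vector, so only the other indices need the assumption.\<close>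

lemma dual_basic_feasible:
  assumes "det (restrict_cols A B) \<noteq> 0"
    and "\<And>j. j \<notin> range B \<Longrightarrow>
       (cramer_solve (transpose (restrict_cols A B)) (restrict_vec c B) v* A) $ j < c $ j"
  shows "cramer_solve (transpose (restrict_cols A B)) (restrict_vec c B) v* A \<le> c"
proof -
  let ?y = "cramer_solve (transpose (restrict_cols A B)) (restrict_vec c B)"
  have "transpose (restrict_cols A B) *v ?y = restrict_vec c B"
    using assms(1) by (intro mult_cramer_solve) simp
  then have "restrict_vec (?y v* A) B = restrict_vec c B"
    by (simp add: restrict_vec_matrix_mult)
  then have "(?y v* A) $ B k = c $ B k" for k
    by (simp add: restrict_vec_def vec_eq_iff)
  then have "(?y v* A) $ j \<le> c $ j" for j
    using assms(2)[of j] by (cases "j \<in> range B") auto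
  then show ?thesis by (simp add: less_eq_vec_def)
qed

text \<open>Weak duality: the basic dual vector is feasible, so its objective bounds every primal
  value from below, and the zero extension of the basic solution attains this bound.\<close>

lemma opt_value_basis:
  assumes "basis_optimal A b c B"
  shows "opt_value A b c = ereal (restrict_vec c B \<bullet> cramer_solve (restrict_cols A B) b)"
proof -
  let ?u = "cramer_solve (restrict_cols A B) b"
  let ?y = "cramer_solve (transpose (restrict_cols A B)) (restrict_vec c B)"
  have d: "det (restrict_cols A B) \<noteq> 0"
    using assms by (simp add: basis_optimal_def)
  have u: "restrict_cols A B *v ?u = b"
    using d by (rule mult_cramer_solve)
  have y: "?y v* restrict_cols A B = restrict_vec c B"
    using mult_cramer_solve[of "transpose (restrict_cols A B)" "restrict_vec c B"] d by simp
  have le: "?y v* A \<le> c"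
    using assms by (intro dual_basic_feasible) (auto simp: basis_optimal_def)
  have "0 \<le> ?u"
    using assms by (auto simp: basis_optimal_def less_eq_vec_def intro: less_imp_le)
  then have mem: "basic_extension B ?u \<in> primal_feasible A b"
    by (simp add: primal_feasible_def basic_extension_nonneg matrix_mult_basic_extension u)
  have "restrict_vec c B \<bullet> ?u \<le> c \<bullet> z" if "z \<in> primal_feasible A b" for z
  proof -
    have "restrict_vec c B \<bullet> ?u = (?y v* restrict_cols A B) \<bullet> ?u"
      by (simp only: y)
    also have "\<dots> = ?y \<bullet> (A *v z)"
      using that by (simp add: dot_lmul_matrix u primal_feasible_def)
    also have "\<dots> \<le> c \<bullet> z"
      using that inner_mono_nonneg[OF le, of z] dot_lmul_matrix[of ?y A z]
      by (simp add: primal_feasible_def)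
    finally show ?thesis .
  qed
  then show ?thesis
    unfolding opt_value_def
    by (intro antisym INF_greatest INF_lower2[OF mem]) (simp_all add: inner_basic_extension)
qed

section \<open>Stability of the basis near the data and on shrinking boxes\<close>

lemma eventually_basis_optimal:
  fixes A :: "real^'n^'m"
  assumes "basis_optimal A b c B"
  shows "\<forall>\<^sub>F p in nhds (A, b, c). basis_optimal (fst p) (fst (snd p)) (snd (snd p)) B"
proof -
  let ?F = "nhds (A, b, c)"
  have t: "((\<lambda>p. fst p) \<longlongrightarrow> A) ?F" "((\<lambda>p. fst (snd p)) \<longlongrightarrow> b) ?F"
      "((\<lambda>p. snd (snd p)) \<longlongrightarrow> c) ?F"
    by (auto intro!: tendsto_eq_intros filterlim_ident)
  have d: "det (restrict_cols A B) \<noteq> 0"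
    using assms by (simp add: basis_optimal_def)
  have 1: "\<forall>\<^sub>F p in ?F. det (restrict_cols (fst p) B) \<noteq> 0"
    by (rule tendsto_imp_eventually_ne[OF _ d]) (intro tendsto_intros t)
  have 2: "\<forall>\<^sub>F p in ?F. 0 < cramer_solve (restrict_cols (fst p) B) (fst (snd p)) $ k" for k
    using assms
    by (intro order_tendstoD(1)[of _ "cramer_solve (restrict_cols A B) b $ k"] tendsto_intros t d)
      (simp add: basis_optimal_def)
  \<comment> \<open>Both sides of the reduced cost inequality vary with \<open>p\<close>, so their
    difference is compared with the constant 0.\<close>
  have 3: "\<forall>\<^sub>F p in ?F. 0 < snd (snd p) $ j -
      (cramer_solve (transpose (restrict_cols (fst p) B)) (restrict_vec (snd (snd p)) B) v* fst p) $ j"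
    if "j \<notin> range B" for j
    by (rule order_tendstoD(1)[of _ "c $ j -
          (cramer_solve (transpose (restrict_cols A B)) (restrict_vec c B) v* A) $ j"],
        intro tendsto_intros t)
      (use assms that d in \<open>auto simp: basis_optimal_def\<close>)
  show ?thesis
    unfolding basis_optimal_def
    using 1 2 3
    by (intro eventually_conj eventually_all_finite) (auto elim: eventually_mono)
qed

text \<open>Componentwise comparison puts the whole box within distance
  \<open>norm (\<alpha> *\<^sub>R M\<Delta>)\<close> of its centre, and this radius tends to 0. The
  type class covers vectors and matrices alike.\<close>

lemma eventually_interval_around:
  fixes M :: "'a::ordered_euclidean_space"
  assumes "eventually P (nhds M)"
  shows "\<forall>\<^sub>F \<alpha> in at_right 0. \<forall>M'\<in>interval_around M M\<Delta> \<alpha>. P M'"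
proof -
  obtain e where e: "e > 0" "\<And>M'. dist M' M < e \<Longrightarrow> P M'"
    using assms by (auto simp: eventually_nhds_metric)
  have "((\<lambda>\<alpha>. norm (\<alpha> *\<^sub>R M\<Delta>)) \<longlongrightarrow> 0) (at_right 0)"
    by (auto intro!: tendsto_eq_intros)
  then have "\<forall>\<^sub>F \<alpha> in at_right 0. norm (\<alpha> *\<^sub>R M\<Delta>) < e"
    using e(1) by (rule order_tendstoD)
  then show ?thesis
  proof eventually_elim
    case (elim \<alpha>)
    have "dist M' M < e" if "M' \<in> interval_around M M\<Delta> \<alpha>" for M'
    proof -
      have "norm (M' - M) \<le> norm (\<alpha> *\<^sub>R M\<Delta>)"
      proof (rule norm_le_componentwise)
        fix i :: 'a assume "i \<in> Basis"
        then have "M \<bullet> i - (\<alpha> *\<^sub>R M\<Delta>) \<bullet> i \<le> M' \<bullet> i" "M' \<bullet> i \<le> M \<bullet> i + (\<alpha> *\<^sub>R M\<Delta>) \<bullet> i"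
          using that eucl_le[of "M - \<alpha> *\<^sub>R M\<Delta>" M'] eucl_le[of M' "M + \<alpha> *\<^sub>R M\<Delta>"]
          by (auto simp: interval_around_def inner_diff_left inner_add_left)
        then show "\<bar>(M' - M) \<bullet> i\<bar> \<le> \<bar>(\<alpha> *\<^sub>R M\<Delta>) \<bullet> i\<bar>"
          by (simp add: inner_diff_left)
      qed
      with elim show ?thesis by (simp add: dist_norm)
    qed
    with e(2) show ?case by blast
  qed
qed

text \<open>A neighbourhood of the triple contains a product of neighbourhoods, so the three factors
  can be shrunk separately.\<close>

lemma eventually_box_around:
  fixes A :: "real^'n^'m" and b :: "real^'m" and c :: "real^'n"
  assumes "eventually P (nhds (A, b, c))"
  shows "\<forall>\<^sub>F \<alpha> in at_right 0. \<forall>p \<in> interval_around A A\<Delta> \<alpha> \<times> interval_around b b\<Delta> \<alpha> \<times>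
           interval_around c c\<Delta> \<alpha>. P p"
proof -
  obtain Pa Q where Pa: "eventually Pa (nhds A)" and Q: "eventually Q (nhds (b, c))"
    and 1: "\<And>A' q. Pa A' \<Longrightarrow> Q q \<Longrightarrow> P (A', q)"
    using assms unfolding nhds_prod[of A] eventually_prod_filter by blast
  obtain Pb Pc where Pb: "eventually Pb (nhds b)" and Pc: "eventually Pc (nhds c)"
    and 2: "\<And>b' c'. Pb b' \<Longrightarrow> Pc c' \<Longrightarrow> Q (b', c')"
    using Q unfolding nhds_prod eventually_prod_filter by blast
  show ?thesis
    using eventually_interval_around[OF Pa, of A\<Delta>] eventually_interval_around[OF Pb, of b\<Delta>]
      eventually_interval_around[OF Pc, of c\<Delta>]
    by eventually_elim (auto intro!: 1 2)
qed

section \<open>What the unique nondegenerate optimum says about the basis and the dual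
  solution\<close>

lemma unique_optimal_basis:
  fixes A :: "real^'n^'m"
  assumes "primal_optimal A b c x"
    and unique: "\<And>z. primal_optimal A b c z \<Longrightarrow> z = x"
    and "is_basis A B"
    and "basic_solution A b B x"
    and "nondegenerate x B"
  shows "restrict_vec x B = cramer_solve (restrict_cols A B) b" and "basis_optimal A b c B"
proof -
  let ?M = "restrict_cols A B"
  let ?u = "restrict_vec x B"
  let ?y = "cramer_solve (transpose ?M) (restrict_vec c B)"
  have d: "det ?M \<noteq> 0" and "inj B"
    using assms(3) by (auto simp: is_basis_def invertible_det_nz)
  then have x: "basic_extension B ?u = x"
    using assms(4) by (intro basic_extension_restrict) (auto simp: basic_solution_def)
  have upos: "0 < ?u $ k" for k
    using assms(5) by (simp add: nondegenerate_def)
  have Mu: "?M *v ?u = b"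
    using assms(1) matrix_mult_basic_extension[of A B ?u]
    by (simp add: x primal_optimal_def primal_feasible_def)
  then show u: "?u = cramer_solve ?M b"
    using d by (simp add: cramer_solve_iff)
  have y: "?y v* ?M = restrict_vec c B"
    using mult_cramer_solve[of "transpose ?M" "restrict_vec c B"] d by simp
  have "(?y v* A) $ j < c $ j" if j: "j \<notin> range B" for j
  proof (rule ccontr)
    assume le: "\<not> (?y v* A) $ j < c $ j"
    \<comment> \<open>If the reduced cost of \<open>j\<close> were not positive, \<open>j\<close>
      could enter the basis. Here \<open>w\<close> expresses column \<open>j\<close> in the basis
      columns: raising entry \<open>j\<close> to \<open>t\<close> while keeping Ax = b moves the
      basic part by -t w, and the cost changes by \<open>t\<close> times the reduced cost.\<close>
    define w where "w = cramer_solve ?M (column j A)"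
    have Mw: "?M *v w = column j A"
      unfolding w_def using d by (rule mult_cramer_solve)
    have "restrict_vec c B \<bullet> w = (?y v* ?M) \<bullet> w"
      by (simp only: y)
    also have "\<dots> = (?y v* A) $ j"
      by (simp add: dot_lmul_matrix Mw) (simp add: inner_vec_def column_def vector_matrix_mult_def mult.commute)
    finally have cw: "restrict_vec c B \<bullet> w = (?y v* A) $ j" .
    \<comment> \<open>Nondegeneracy leaves room for a step of positive length before any basic entry
      reaches 0.\<close>
    have "\<forall>\<^sub>F t in at_right 0. 0 < ?u $ k - t * w $ k" for k
      by (rule order_tendstoD(1)[OF _ upos[of k]]) (auto intro!: tendsto_eq_intros)
    then have "\<forall>\<^sub>F t in at_right (0::real). t > 0 \<and> (\<forall>k. 0 < ?u $ k - t * w $ k)"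
      by (intro eventually_conj eventually_at_right_less eventually_all_finite)
    then obtain t where t: "t > 0" "\<And>k. 0 < ?u $ k - t * w $ k"
      using eventually_happens'[OF trivial_limit_at_right_real] by blast
    define z where "z = basic_extension B (?u - t *\<^sub>R w) + t *\<^sub>R axis j 1"
    have "A *v z = b"
      by (simp add: z_def matrix_vector_right_distrib matrix_mult_basic_extension
          matrix_vector_mult_diff_distrib matrix_vector_mult_scaleR Mu Mw matrix_vector_mult_basis)
    moreover have "0 \<le> basic_extension B (?u - t *\<^sub>R w)"
      using t(2) by (intro basic_extension_nonneg) (auto simp: less_eq_vec_def intro: less_imp_le)
    then have "0 \<le> z"
      using t(1) by (auto simp: z_def axis_def less_eq_vec_def)
    moreover have "c \<bullet> z = c \<bullet> x + t * (c $ j - (?y v* A) $ j)"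
    proof -
      have "c \<bullet> x = restrict_vec c B \<bullet> ?u"
        using inner_basic_extension[of c B ?u] by (simp add: x)
      then show ?thesis
        by (simp add: z_def inner_add_right inner_basic_extension inner_diff_right cw inner_axis
            algebra_simps)
    qed
    then have "c \<bullet> z \<le> c \<bullet> x"
      using t(1) le by (simp add: mult_nonneg_nonpos)
    \<comment> \<open>The shifted point costs no more than \<open>x\<close> and is therefore also
      optimal, but its entry \<open>j\<close> is t > 0, where \<open>x\<close> has 0. This
      contradicts uniqueness.\<close>
    ultimately have "primal_optimal A b c z"
      using assms(1) by (auto simp: primal_optimal_def primal_feasible_def intro: order_trans)
    then have "z = x" by (rule unique)
    moreover have "z $ j = t"
      using j by (simp add: z_def basic_extension_outside)
    moreover have "x $ j = 0"
      using j assms(4) by (simp add: basic_solution_def)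
    ultimately show False using t(1) by simp
  qed
  then show "basis_optimal A b c B"
    using d upos unfolding basis_optimal_def u by blast
qed

text \<open>Complementary slackness: the basic dual vector is a feasible competitor, so the slack
  c_B - y A_B has a nonpositive inner product with the basic solution. The slack is nonnegative and
  the basic solution is positive, so every product of their entries, and with it the slack, is
  0.\<close>

lemma dual_optimal_basis:
  fixes A :: "real^'n^'m"
  assumes "basis_optimal A b c B" and "dual_optimal A b c y"
  shows "y v* restrict_cols A B = restrict_vec c B"
proof -
  let ?M = "restrict_cols A B"
  let ?u = "cramer_solve ?M b"
  let ?y = "cramer_solve (transpose ?M) (restrict_vec c B)"
  have d: "det ?M \<noteq> 0" and u: "\<And>k. 0 < ?u $ k"
    using assms(1) by (auto simp: basis_optimal_def)
  have b: "b \<bullet> z = (z v* ?M) \<bullet> ?u" for z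
    using mult_cramer_solve[OF d, of b] by (simp add: dot_lmul_matrix inner_commute)
  have "?y v* A \<le> c"
    using assms(1) by (intro dual_basic_feasible) (auto simp: basis_optimal_def)
  then have "b \<bullet> ?y \<le> b \<bullet> y"
    using assms(2) by (simp add: dual_optimal_def dual_feasible_def)
  moreover have "?y v* ?M = restrict_vec c B"
    using mult_cramer_solve[of "transpose ?M" "restrict_vec c B"] d by simp
  ultimately have "(restrict_vec c B - y v* ?M) \<bullet> ?u \<le> 0"
    unfolding b by (simp add: inner_diff_left)
  moreover have "0 \<le> (restrict_vec c B - y v* ?M) $ k" for k
  proof -
    have "(y v* A) $ B k \<le> c $ B k"
      using assms(2) by (simp add: dual_optimal_def dual_feasible_def less_eq_vec_def)
    then show ?thesis
      by (simp flip: restrict_vec_matrix_mult) (simp add: restrict_vec_def)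
  qed
  moreover from this have "0 \<le> (restrict_vec c B - y v* ?M) $ k * ?u $ k" for k
    using u[of k] by (intro mult_nonneg_nonneg) auto
  ultimately have "(restrict_vec c B - y v* ?M) $ k * ?u $ k = 0" for k
    unfolding inner_vec_def inner_real_def
    by (metis (mono_tags, lifting) UNIV_I finite sum_nonneg sum_nonneg_eq_0_iff antisym)
  then show ?thesis
    using u by (simp add: vec_eq_iff less_imp_neq[symmetric] neq_iff)
qed

section \<open>Exact change of the value, bounds for it, and attainment of the maximum\<close>

lemma basis_value_diff:
  fixes M M' :: "real^'m^'m"
  assumes "M *v u = b" and "M' *v u' = b'" and "y v* M = c"
  shows "c' \<bullet> u' - c \<bullet> u = (c' - c) \<bullet> u' - y \<bullet> ((M' - M) *v u') + y \<bullet> (b' - b)"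
  \<comment> \<open>From y M = c follow c u = y b and c u' = y (M u'). Measuring the changes of
    matrix and cost at the new solution u' leaves no second-order remainder.\<close>
  using dot_lmul_matrix[of y M u'] dot_lmul_matrix[of y M u] assms
  by (simp add: inner_diff_left inner_diff_right matrix_vector_mult_diff_rdistrib)

lemma inner_matrix_vector: "y \<bullet> (N *v v) = (\<Sum>i\<in>UNIV. \<Sum>k\<in>UNIV. y $ i * N $ i $ k * v $ k)"
  for N :: "real^'n^'m"
  by (simp add: inner_vec_def matrix_vector_mult_def sum_distrib_left mult.assoc)

lemma inner_matrix_vector_bound:
  fixes N D :: "real^'n^'m"
  assumes "\<And>i k. \<bar>N $ i $ k\<bar> \<le> D $ i $ k" and "0 \<le> v"
  shows "- (y \<bullet> (N *v v)) \<le> \<bar>y\<bar> \<bullet> (D *v v)"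
proof -
  have "- (y $ i * N $ i $ k * v $ k) \<le> \<bar>y $ i\<bar> * D $ i $ k * v $ k" for i k
  proof -
    have "- (y $ i * N $ i $ k) \<le> \<bar>y $ i\<bar> * \<bar>N $ i $ k\<bar>"
      by (metis abs_ge_minus_self abs_mult)
    also have "\<dots> \<le> \<bar>y $ i\<bar> * D $ i $ k"
      using assms(1) by (intro mult_left_mono) auto
    finally show ?thesis
      using assms(2) mult_right_mono[of _ _ "v $ k"] by (fastforce simp: less_eq_vec_def)
  qed
  then show ?thesis
    by (auto simp: inner_matrix_vector abs_vec_def simp flip: sum_negf intro!: sum_mono)
qed

lemma inner_bound:
  fixes y :: "real^'m"
  assumes "\<And>i. \<bar>v $ i\<bar> \<le> d $ i"
  shows "y \<bullet> v \<le> \<bar>y\<bar> \<bullet> d"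
proof -
  have "y $ i * v $ i \<le> \<bar>y $ i\<bar> * d $ i" for i
    using assms mult_left_mono[of "\<bar>v $ i\<bar>" "d $ i" "\<bar>y $ i\<bar>"] abs_ge_self[of "y $ i * v $ i"]
    by (simp add: abs_mult)
  then show ?thesis
    by (auto simp: inner_vec_def abs_vec_def intro!: sum_mono)
qed

text \<open>\<open>GREATEST\<close> can be evaluated only once a greatest element is known, so
  compactness and continuity first supply a maximiser.\<close>

lemma worst_case_value_attained:
  fixes \<A> :: "(real^'n^'m) set"
  assumes "compact (\<A> \<times> \<B> \<times> \<C>)" and "\<A> \<times> \<B> \<times> \<C> \<noteq> {}" and "continuous_on (\<A> \<times> \<B> \<times> \<C>) g"
    and val: "\<And>A' b' c'. (A', b', c') \<in> \<A> \<times> \<B> \<times> \<C> \<Longrightarrow> opt_value A' b' c' = ereal (g (A', b', c'))"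
  obtains p where "p \<in> \<A> \<times> \<B> \<times> \<C>" and "worst_case_value \<A> \<B> \<C> = ereal (g p)"
    and "\<And>q. q \<in> \<A> \<times> \<B> \<times> \<C> \<Longrightarrow> g q \<le> g p"
proof -
  obtain p where p: "p \<in> \<A> \<times> \<B> \<times> \<C>" "\<And>q. q \<in> \<A> \<times> \<B> \<times> \<C> \<Longrightarrow> g q \<le> g p"
    using continuous_attains_sup[OF assms(1-3)] by blast
  obtain A' b' c' where "p = (A', b', c')" by (cases p)
  with p val[of A' b' c'] have "ereal (g p) \<in> {opt_value A' b' c' | A' b' c'. A' \<in> \<A> \<and> b' \<in> \<B> \<and> c' \<in> \<C>}"
    by force
  then have "worst_case_value \<A> \<B> \<C> = ereal (g p)"
    unfolding worst_case_value_def
    by (rule Greatest_equality) (use p(2) val in auto)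
  with p that show thesis by blast
qed

lemma interval_around_nth:
  fixes M :: "real^'n"
  shows "M' \<in> interval_around M D \<alpha> \<longleftrightarrow> (\<forall>i. \<bar>M' $ i - M $ i\<bar> \<le> \<alpha> * D $ i)"
  by (fastforce simp: interval_around_def less_eq_vec_def abs_le_iff algebra_simps)

lemma interval_around_nth_nth:
  fixes M :: "real^'n^'m"
  shows "M' \<in> interval_around M D \<alpha> \<longleftrightarrow> (\<forall>i j. \<bar>M' $ i $ j - M $ i $ j\<bar> \<le> \<alpha> * D $ i $ j)"
  by (fastforce simp: interval_around_def less_eq_vec_def abs_le_iff algebra_simps)

theorem proposition1:
  fixes A A\<Delta> :: "real^'n^'m"
    and b b\<Delta> y :: "real^'m"
    and c c\<Delta> x :: "real^'n"
    and B :: "'m \<Rightarrow> 'n"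
  assumes "0 \<le> A\<Delta>" and "0 \<le> b\<Delta>" and "0 \<le> c\<Delta>"
    and "primal_optimal A b c x"
    and "\<And>z. primal_optimal A b c z \<Longrightarrow> z = x"
    and "is_basis A B"
    and "basic_solution A b B x"
    and "nondegenerate x B"
    and "dual_optimal A b c y"
  shows "has_worst_case_derivative A b c A\<Delta> b\<Delta> c\<Delta>
           (ereal (\<bar>y\<bar> \<bullet> (restrict_cols A\<Delta> B *v restrict_vec x B)
                   + \<bar>y\<bar> \<bullet> b\<Delta>
                   + restrict_vec x B \<bullet> restrict_vec c\<Delta> B))"
proof -
  define u where "u p = cramer_solve (restrict_cols (fst p) B) (fst (snd p))"
    for p :: "(real^'n^'m) \<times> (real^'m) \<times> (real^'n)"
  define g where "g p = restrict_vec (snd (snd p)) B \<bullet> u p" for p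
  define h where "h v = \<bar>y\<bar> \<bullet> (restrict_cols A\<Delta> B *v v) + \<bar>y\<bar> \<bullet> b\<Delta> + v \<bullet> restrict_vec c\<Delta> B" for v
  define K where "K \<alpha> = interval_around A A\<Delta> \<alpha> \<times> interval_around b b\<Delta> \<alpha> \<times> interval_around c c\<Delta> \<alpha>"
    for \<alpha>
  define W where "W \<alpha> = worst_case_value (interval_around A A\<Delta> \<alpha>) (interval_around b b\<Delta> \<alpha>)
      (interval_around c c\<Delta> \<alpha>)" for \<alpha>
  define good where "good p \<longleftrightarrow> basis_optimal (fst p) (fst (snd p)) (snd (snd p)) B" for p
  let ?p0 = "(A, b, c)"
  have u0: "restrict_vec x B = u ?p0" and good0: "good ?p0"
    using unique_optimal_basis[OF assms(4-8)] by (simp_all add: u_def good_def)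
  have yM: "y v* restrict_cols A B = restrict_vec c B"
    using dual_optimal_basis[OF _ assms(9)] good0 by (simp add: good_def)
  have val: "opt_value A' b' c' = ereal (g (A', b', c'))" if "good (A', b', c')" for A' b' c'
    using opt_value_basis that by (simp add: g_def u_def good_def)
  have det: "det (restrict_cols (fst p) B) \<noteq> 0" if "good p" for p
    using that by (simp add: good_def basis_optimal_def)
  have solves: "restrict_cols (fst p) B *v u p = fst (snd p)" if "good p" for p
    unfolding u_def using det[OF that] by (rule mult_cramer_solve)
  have tendsto_u: "(u \<longlongrightarrow> u p) (nhds p)" if "good p" for p
    unfolding u_def by (intro tendsto_intros filterlim_ident det that)
  have diff: "g p - g ?p0 = restrict_vec (snd (snd p) - c) B \<bullet> u p
      - y \<bullet> (restrict_cols (fst p - A) B *v u p) + y \<bullet> (fst (snd p) - b)" if "good p" for p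
    using basis_value_diff[OF solves[OF good0] solves[OF that], of y "restrict_vec c B"
        "restrict_vec (snd (snd p)) B"] yM
    by (simp add: g_def restrict_vec_def restrict_cols_def minus_vec_def)

  \<comment> \<open>The bound keeps the perturbed solution \<open>u p\<close>, which is nonnegative
    because \<open>p\<close> is good. Passing from \<open>u p\<close> to x_B is left to the
    limit.\<close>
  have upper: "g p - g ?p0 \<le> \<alpha> * h (u p)" if "p \<in> K \<alpha>" "good p" for p \<alpha>
  proof -
    have upos: "0 \<le> u p"
      using that(2) by (auto simp: good_def basis_optimal_def u_def less_eq_vec_def intro: less_imp_le)
    obtain A' b' c' where p: "p = (A', b', c')" by (cases p)
    have A': "\<bar>restrict_cols (A' - A) B $ i $ k\<bar> \<le> (\<alpha> *\<^sub>R restrict_cols A\<Delta> B) $ i $ k" for i k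
      using that(1) by (simp add: K_def p interval_around_nth_nth restrict_cols_def)
    have b': "\<bar>(b' - b) $ i\<bar> \<le> (\<alpha> *\<^sub>R b\<Delta>) $ i" for i
      using that(1) by (simp add: K_def p interval_around_nth)
    have "restrict_vec (c' - c) B \<le> \<alpha> *\<^sub>R restrict_vec c\<Delta> B"
      using that(1) by (simp add: K_def p interval_around_nth restrict_vec_def less_eq_vec_def abs_le_iff)
    then have "restrict_vec (c' - c) B \<bullet> u p \<le> (\<alpha> *\<^sub>R restrict_vec c\<Delta> B) \<bullet> u p"
      using upos by (rule inner_mono_nonneg)
    moreover have "- (y \<bullet> (restrict_cols (A' - A) B *v u p))
        \<le> \<bar>y\<bar> \<bullet> ((\<alpha> *\<^sub>R restrict_cols A\<Delta> B) *v u p)"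
      using A' upos by (rule inner_matrix_vector_bound)
    moreover have "y \<bullet> (b' - b) \<le> \<bar>y\<bar> \<bullet> (\<alpha> *\<^sub>R b\<Delta>)"
      using b' by (rule inner_bound)
    ultimately show ?thesis
      unfolding diff[OF that(2)]
      by (simp add: p h_def scaleR_matrix_vector_assoc[symmetric] inner_commute algebra_simps)
  qed

  \<comment> \<open>Goodness is a premise inside the existential so that the same fact also shows
    \<open>K \<alpha>\<close> to be nonempty.\<close>
  have lower: "\<exists>q \<in> K \<alpha>. good q \<longrightarrow> g q - g ?p0 = \<alpha> * h (u q)" if "\<alpha> > 0" for \<alpha>
  proof -
    \<comment> \<open>The matrix change enters the value difference with a minus sign and the
      right-hand side with a plus sign, hence the opposite signs; costs rise fully because basic
      entries are positive for good data. Where y is 0, \<open>sgn\<close> leaves the row unchanged,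
      at no loss.\<close>
    define q where "q = (A - \<alpha> *\<^sub>R (\<chi> i j. sgn (y $ i) * A\<Delta> $ i $ j),
        b + \<alpha> *\<^sub>R (\<chi> i. sgn (y $ i) * b\<Delta> $ i), c + \<alpha> *\<^sub>R c\<Delta>)"
    have "\<bar>sgn t\<bar> * d \<le> d" if "0 \<le> d" for t d :: real
      using that by (simp add: abs_sgn_eq)
    then have "q \<in> K \<alpha>"
      using that assms(1-3)
      by (auto simp: q_def K_def interval_around_nth interval_around_nth_nth abs_mult less_eq_vec_def)
    moreover have "g q - g ?p0 = \<alpha> * h (u q)" if "good q"
    proof -
      have "- (y \<bullet> (restrict_cols (fst q - A) B *v u q)) = \<alpha> * (\<bar>y\<bar> \<bullet> (restrict_cols A\<Delta> B *v u q))"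
        by (simp add: q_def inner_matrix_vector restrict_cols_def abs_vec_def abs_sgn sum_distrib_left
            mult_ac flip: sum_negf)
      moreover have "y \<bullet> (fst (snd q) - b) = \<alpha> * (\<bar>y\<bar> \<bullet> b\<Delta>)"
        by (simp add: q_def inner_vec_def abs_vec_def abs_sgn sum_distrib_left mult_ac)
      moreover have "restrict_vec (snd (snd q) - c) B \<bullet> u q = \<alpha> * (u q \<bullet> restrict_vec c\<Delta> B)"
        by (simp add: q_def inner_vec_def restrict_vec_def sum_distrib_left mult_ac)
      ultimately show ?thesis
        unfolding diff[OF that] by (simp add: h_def algebra_simps)
    qed
    ultimately show ?thesis by blast
  qed

  have attained: "\<exists>p \<in> K \<alpha>. W \<alpha> = ereal (g p) \<and> (\<forall>q \<in> K \<alpha>. g q \<le> g p)"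
    if "\<alpha> > 0" and good: "\<And>p. p \<in> K \<alpha> \<Longrightarrow> good p" for \<alpha>
  proof -
    have "compact (K \<alpha>)"
      unfolding K_def interval_around_def by (intro compact_Times compact_interval)
    moreover have "K \<alpha> \<noteq> {}"
      using lower[OF that(1)] by blast
    moreover have "continuous_on (K \<alpha>) g"
      unfolding g_def
      by (intro continuous_at_imp_continuous_on ballI)
        (auto simp: isCont_def intro!: tendsto_intros tendsto_mono[OF at_within_le_nhds tendsto_u] good)
    ultimately show ?thesis
      using val good unfolding K_def W_def by (metis worst_case_value_attained)
  qed

  have tendsto_h: "((\<lambda>p. h (u p)) \<longlongrightarrow> h (restrict_vec x B)) (nhds ?p0)"
    unfolding h_def u0 by (intro tendsto_intros tendsto_u good0)
  have ev_good: "\<forall>\<^sub>F p in nhds ?p0. good p"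
    using eventually_basis_optimal[of A b c B] good0 by (simp add: good_def)
  have close: "\<forall>\<^sub>F \<alpha> in at_right 0. \<exists>r. W \<alpha> = ereal r \<and> \<bar>(r - g ?p0) / \<alpha> - h (restrict_vec x B)\<bar> < e"
    if "e > 0" for e
  proof -
    have "\<forall>\<^sub>F p in nhds ?p0. good p \<and> \<bar>h (u p) - h (restrict_vec x B)\<bar> < e"
      using ev_good tendstoD[OF tendsto_h that] by eventually_elim (simp add: dist_real_def)
    then have "\<forall>\<^sub>F \<alpha> in at_right 0. \<forall>p \<in> K \<alpha>. good p \<and> \<bar>h (u p) - h (restrict_vec x B)\<bar> < e"
      unfolding K_def by (rule eventually_box_around)
    then show ?thesis
      using eventually_at_right_less[of 0]
    proof eventually_elim
      case (elim \<alpha>)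
      obtain p where p: "p \<in> K \<alpha>" "W \<alpha> = ereal (g p)" "\<And>q. q \<in> K \<alpha> \<Longrightarrow> g q \<le> g p"
        using attained[of \<alpha>] elim by blast
      obtain q where q: "q \<in> K \<alpha>" "g q - g ?p0 = \<alpha> * h (u q)"
        using lower[of \<alpha>] elim by blast
      \<comment> \<open>The maximiser \<open>p\<close> does at least as well as the explicit
        \<open>q\<close>, and \<open>upper\<close> bounds it from above. Both ends of this sandwich
        are within \<open>e\<close> of the limit, as \<open>p\<close> and \<open>q\<close> lie in
        the small box.\<close>
      have "h (u q) \<le> (g p - g ?p0) / \<alpha>"
        using q p(3)[of q] elim by (simp add: field_simps)
      moreover have "(g p - g ?p0) / \<alpha> \<le> h (u p)"
        using upper[OF p(1)] p(1) elim by (simp add: field_simps)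
      moreover have "\<bar>h (u p) - h (restrict_vec x B)\<bar> < e" "\<bar>h (u q) - h (restrict_vec x B)\<bar> < e"
        using elim p(1) q(1) by auto
      ultimately have "\<bar>(g p - g ?p0) / \<alpha> - h (restrict_vec x B)\<bar> < e"
        by linarith
      with p(2) show ?case by blast
    qed
  qed
  \<comment> \<open>The limit is taken among real quotients and then embedded.
    \<open>W \<alpha>\<close> need not be real for large \<alpha>, but by \<open>close\<close> it is
    so eventually, and there the real and extended quotients agree.\<close>
  have "((\<lambda>\<alpha>. (real_of_ereal (W \<alpha>) - g ?p0) / \<alpha>) \<longlongrightarrow> h (restrict_vec x B)) (at_right 0)"
    by (rule tendstoI) (use close in \<open>force elim!: eventually_mono simp: dist_real_def\<close>)
  then have "((\<lambda>\<alpha>. ereal ((real_of_ereal (W \<alpha>) - g ?p0) / \<alpha>)) \<longlongrightarrow> ereal (h (restrict_vec x B)))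
      (at_right 0)"
    by (rule tendsto_ereal)
  moreover have "\<forall>\<^sub>F \<alpha> in at_right 0.
      ereal ((real_of_ereal (W \<alpha>) - g ?p0) / \<alpha>) = (W \<alpha> - opt_value A b c) / ereal \<alpha>"
    using close[OF zero_less_one] eventually_at_right_less[of 0]
    by eventually_elim (auto simp: val[OF good0])
  ultimately show ?thesis
    unfolding has_worst_case_derivative_def W_def h_def
    by (rule Lim_transform_eventually)
qed

end
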